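(* Let $0<l<h$ be arbitrary values (possibly depending on the number $n$ of agents), let all private valuations lie in $\{l,h\}$, and let $\mathcal{T}$ be the transformation that, given any algorithm $\mathcal{A}$, returns the constant allocation $\mathcal{A}(l,l,\dots,l)$ at every input. Then $\mathcal{T}$ preserves an $l/h$ fraction of the approximation ratio; that is, for every feasibility set $\mathcal{F}$ and every algorithm $\mathcal{A}$ for $\mathcal{F}$, $$approx_{\mathcal{F}}(\mathcal{T}(\mathcal{A}))\ \ge\ \frac{l}{h}\cdot approx_{\mathcal{F}}(\mathcal{A}).$$
   Context: There are $n$ agents; agent $i$ has a private valuation $v_i\in\{l,h\}$. An allocation is a vector $\mathbf{x}=(x_1,\dots,x_n)$ of nonnegative reals. The feasibility set $\mathcal{F}$ is a nonempty set of allocations that is downward-closed (decreasing the nonnegative amount given to an agent keeps an allocation feasible) and for which the maximum welfare defined below exists. An algorithm (allocation rule) for $\mathcal{F}$ is a function $\mathcal{A}:\{l,h\}^n\to\mathcal{F}$. Its welfare at $\mathbf{v}$, also written $\mathcal{A}(\mathbf{v})$, is $\sum_i v_ix_i$ where $\mathbf{x}$ is the allocation returned at $\mathbf{v}$. Let $OPT_{\mathcal{F}}(\mathbf{v})=\max_{\mathbf{x}\in\mathcal{F}}\sum_i v_ix_i$. The (worst-case) approximation ratio of $\mathcal{A}$ is $approx_{\mathcal{F}}(\mathcal{A})=\min_{\mathbf{v}\in\{l,h\}^n}\frac{\mathcal{A}(\mathbf{v})}{OPT_{\mathcal{F}}(\mathbf{v})}$ (with $0/0=1$). A transformation $\mathcal{T}$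 with access to $\mathcal{A}$ defines a new allocation rule $\mathcal{T}(\mathcal{A})$; here $\mathcal{T}(\mathcal{A})$ returns the allocation $\mathcal{A}(l,\dots,l)$ at every $\mathbf{v}\in\{l,h\}^n$. *)

theory Defs
  imports Complex_Main "HOL-Library.FuncSet"
begin

text \<open>
  The agents are the elements of a finite type \<open>'n\<close>, so the number of agents is \<open>CARD('n)\<close>.
  Valuation vectors and allocations are functions \<open>'n \<Rightarrow> real\<close>.
\<close>

definition valuations :: "real \<Rightarrow> real \<Rightarrow> ('n::finite \<Rightarrow> real) set" where
  "valuations l h = {v. \<forall>i. v i \<in> {l, h}}"

definition welfare :: "('n::finite \<Rightarrow> real) \<Rightarrow> ('n \<Rightarrow> real) \<Rightarrow> real" where
  "welfare v x = (\<Sum>i\<in>UNIV. v i * x i)"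

definition feasibility_set :: "real \<Rightarrow> real \<Rightarrow> ('n::finite \<Rightarrow> real) set \<Rightarrow> bool" where
  "feasibility_set l h F \<longleftrightarrow>
     F \<noteq> {} \<and>
     (\<forall>x\<in>F. \<forall>i. 0 \<le> x i) \<and>
     (\<forall>x\<in>F. \<forall>i t. 0 \<le> t \<and> t \<le> x i \<longrightarrow> x(i := t) \<in> F) \<and>
     (\<forall>v\<in>valuations l h. \<exists>x\<in>F. \<forall>y\<in>F. welfare v y \<le> welfare v x)"

text \<open>
  An allocation rule is only required to be feasible on \<open>valuations l h\<close>; its values elsewhere are
  irrelevant.
\<close>

definition algorithm ::
  "real \<Rightarrow> real \<Rightarrow> ('n::finite \<Rightarrow> real) set \<Rightarrow> (('n \<Rightarrow> real) \<Rightarrow> ('n \<Rightarrow> real)) \<Rightarrow> bool" where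
  "algorithm l h F A \<longleftrightarrow> A \<in> valuations l h \<rightarrow> F"

definition OPT :: "('n::finite \<Rightarrow> real) set \<Rightarrow> ('n \<Rightarrow> real) \<Rightarrow> real" where
  "OPT F v = (GREATEST w. w \<in> welfare v ` F)"

text \<open>Division with the convention \<open>0/0 = 1\<close> (in HOL, \<open>0/0 = 0\<close>).\<close>

definition ratio :: "real \<Rightarrow> real \<Rightarrow> real" where
  "ratio a b = (if a = 0 \<and> b = 0 then 1 else a / b)"

definition approx ::
  "real \<Rightarrow> real \<Rightarrow> ('n::finite \<Rightarrow> real) set \<Rightarrow> (('n \<Rightarrow> real) \<Rightarrow> ('n \<Rightarrow> real)) \<Rightarrow> real" where
  "approx l h F A = Min ((\<lambda>v. ratio (welfare v (A v)) (OPT F v)) ` valuations l h)"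

definition const_transform ::
  "real \<Rightarrow> (('n::finite \<Rightarrow> real) \<Rightarrow> ('n \<Rightarrow> real)) \<Rightarrow> (('n \<Rightarrow> real) \<Rightarrow> ('n \<Rightarrow> real))" where
  "const_transform l A = (\<lambda>v. A (\<lambda>i. l))"

text \<open>
  \<open>Min\<close> and \<open>GREATEST\<close> above are genuine: the set of valuations is finite and nonempty, and the
  optimum is attained.
\<close>

lemma finite_valuations: "finite (valuations l h :: ('n::finite \<Rightarrow> real) set)"
proof -
  have "valuations l h = (UNIV :: 'n set) \<rightarrow>\<^sub>E {l, h}"
    by (auto simp: valuations_def PiE_def Pi_def)
  then show ?thesis
    by (simp add: finite_PiE)
qed

lemma const_low_in_valuations: "(\<lambda>i. l) \<in> valuations l h"
  by (simp add: valuations_def)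

lemma OPT_is_max:
  assumes "feasibility_set l h F" and "v \<in> valuations l h"
  shows "OPT F v \<in> welfare v ` F" and "\<And>x. x \<in> F \<Longrightarrow> welfare v x \<le> OPT F v"
proof -
  obtain x where x: "x \<in> F" "\<forall>y\<in>F. welfare v y \<le> welfare v x"
    using assms unfolding feasibility_set_def by blast
  have "OPT F v = welfare v x"
    unfolding OPT_def by (rule Greatest_equality) (use x in auto)
  with x show "OPT F v \<in> welfare v ` F" and "\<And>x. x \<in> F \<Longrightarrow> welfare v x \<le> OPT F v"
    by auto
qed

lemma algorithm_const_transform:
  "algorithm l h F A \<Longrightarrow> algorithm l h F (const_transform l A)"
  using const_low_in_valuations by (auto simp: algorithm_def const_transform_def)

end

theory Submission
  imports Defs
begin

text \<open>
  Write \<open>L\<close> for the all-low input. For every input \<open>v\<close> we have \<open>l \<le> v i \<le> h\<close>, so a nonnegative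
  allocation satisfies \<open>welfare L x \<le> welfare v x \<le> (h / l) * welfare L x\<close>. The first inequality,
  applied to \<open>A L\<close>, and the second, applied to an optimal allocation at \<open>v\<close>, bound the ratio of the
  constant rule at \<open>v\<close> below by \<open>l / h\<close> times the ratio of \<open>A\<close> at \<open>L\<close>.
\<close>

lemma valuations_bounds:
  assumes "l \<le> h" and "v \<in> valuations l h"
  shows "l \<le> v i" and "v i \<le> h"
  using assms unfolding valuations_def by (auto dest: spec[of _ i])

lemma welfare_mono:
  assumes "\<And>i. v i \<le> w i" and "\<And>i. 0 \<le> x i"
  shows "welfare v x \<le> welfare w x"
  unfolding welfare_def by (intro sum_mono mult_right_mono assms)

lemma welfare_nonneg:
  assumes "\<And>i. 0 \<le> v i" and "\<And>i. 0 \<le> x i"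
  shows "0 \<le> welfare v x"
  unfolding welfare_def by (intro sum_nonneg mult_nonneg_nonneg assms)

lemma feasible_nonneg: "feasibility_set l h F \<Longrightarrow> x \<in> F \<Longrightarrow> 0 \<le> x i"
  by (simp add: feasibility_set_def)

lemma ratio_le_1: "0 \<le> a \<Longrightarrow> a \<le> b \<Longrightarrow> ratio a b \<le> 1"
  by (auto simp: ratio_def divide_le_eq)

text \<open>For positive denominators, multiplying \<open>a \<le> a'\<close> by
  \<open>c * b' \<le> b\<close> and dividing by \<open>b * b'\<close> gives the claim; the
  convention 0/0 = 1 forces zero denominators to be treated apart.\<close>

lemma scaled_ratio_le:
  assumes "0 \<le> c" "c \<le> 1" and "0 \<le> a" "a \<le> b" and "a \<le> a'" "a' \<le> b'" and "c * b' \<le> b"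
  shows "c * ratio a b \<le> ratio a' b'"
proof (cases "b' = 0")
  case True
  \<comment> \<open>Here \<open>a'\<close> is squeezed to 0, so the convention 0/0 = 1
    applies.\<close>
  with assms have "ratio a' b' = 1" by (simp add: ratio_def)
  moreover have "c * ratio a b \<le> 1 * 1"
    by (rule mult_mono') (use assms ratio_le_1[of a b] in \<open>auto simp: ratio_def\<close>)
  ultimately show ?thesis by simp
next
  case False
  with assms have b': "0 < b'" by linarith
  show ?thesis
  proof (cases "b = 0")
    case True
    \<comment> \<open>Since \<open>c * b' \<le> 0\<close> with \<open>b'\<close> positive,
      \<open>c\<close> vanishes, which cancels the value 1 of \<open>ratio a b\<close>.\<close>
    with assms b' have "c = 0" by (smt (verit) mult_pos_pos)
    with assms b' show ?thesis by (simp add: ratio_def)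
  next
    case False
    with assms have b: "0 < b" by linarith
    have "a * (c * b') \<le> a' * b"
      using assms b' by (intro mult_mono) auto
    with b b' show ?thesis by (simp add: ratio_def divide_simps mult.commute mult.left_commute)
  qed
qed

text \<open>The factor \<open>l / h\<close> brings every \<open>v i \<le> h\<close> down to at most
  \<open>l\<close>, so an allocation optimal at \<open>v\<close> is a good enough competitor at the
  all-low input.\<close>

lemma OPT_le_scaled_OPT_low:
  fixes F :: "('n::finite \<Rightarrow> real) set"
  assumes "0 < l" "l \<le> h" and F: "feasibility_set l h F" and v: "v \<in> valuations l h"
  shows "l / h * OPT F v \<le> OPT F (\<lambda>i. l)"
proof -
  obtain x where x: "x \<in> F" "OPT F v = welfare v x"
    using OPT_is_max(1)[OF F v] by auto
  have "l / h * welfare v x = welfare (\<lambda>i. l / h * v i) x"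
    by (simp add: welfare_def sum_distrib_left mult.assoc)
  also have "\<dots> \<le> welfare (\<lambda>i. l) x"
  proof (rule welfare_mono)
    show "l / h * v i \<le> l" for i
      using assms(1,2) valuations_bounds(2)[OF assms(2) v, of i] by (simp add: divide_le_eq)
    show "0 \<le> x i" for i
      using feasible_nonneg[OF F x(1)] .
  qed
  also have "\<dots> \<le> OPT F (\<lambda>i. l)"
    using OPT_is_max(2)[OF F const_low_in_valuations x(1)] .
  finally show ?thesis by (simp add: x(2))
qed

theorem theorem8:
  fixes l h :: real
    and F :: "('n::finite \<Rightarrow> real) set"
    and A :: "('n \<Rightarrow> real) \<Rightarrow> ('n \<Rightarrow> real)"
  assumes "0 < l" and "l < h"
    and "feasibility_set l h F"
    and "algorithm l h F A"
  shows "approx l h F (const_transform l A) \<ge> (l / h) * approx l h F A"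
proof -
  let ?L = "(\<lambda>i. l) :: 'n \<Rightarrow> real"
  let ?V = "valuations l h :: ('n \<Rightarrow> real) set"
  let ?r = "ratio (welfare ?L (A ?L)) (OPT F ?L)"
  have L: "?L \<in> ?V" by (rule const_low_in_valuations)
  have AL: "A ?L \<in> F" using assms(4) L by (auto simp: algorithm_def)
  have nonneg: "0 \<le> A ?L i" for i using feasible_nonneg[OF assms(3) AL] .
  \<comment> \<open>The constant rule sees \<open>A\<close> only at the all-low input, so this one
    term of the minimum suffices.\<close>
  have "approx l h F A \<le> ?r"
    unfolding approx_def using L by (intro Min_le finite_imageI finite_valuations) auto
  then have low: "l / h * approx l h F A \<le> l / h * ?r"
    using assms(1,2) by (intro mult_left_mono) auto
  have bound: "l / h * ?r \<le> ratio (welfare v (A ?L)) (OPT F v)" if v: "v \<in> ?V" for v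
  \<comment> \<open>Here \<open>c\<close> is \<open>l / h\<close>; \<open>a\<close>,
    \<open>b\<close> are welfare and optimum at \<open>?L\<close>, and \<open>a'\<close>,
    \<open>b'\<close> those at \<open>v\<close>, for the same allocation
    \<open>A ?L\<close>.\<close>
  proof (rule scaled_ratio_le)
    show "0 \<le> welfare ?L (A ?L)"
      using assms(1) nonneg by (intro welfare_nonneg) auto
    show "welfare ?L (A ?L) \<le> welfare v (A ?L)"
      using valuations_bounds(1)[OF _ v] assms(2) nonneg by (intro welfare_mono) auto
    show "l / h * OPT F v \<le> OPT F ?L"
      using OPT_le_scaled_OPT_low[OF _ _ assms(3) v] assms(1,2) by simp
  qed (use assms(1,2) OPT_is_max(2)[OF assms(3) _ AL] L v in auto)
  have "l / h * approx l h F A \<le> ratio (welfare v (A ?L)) (OPT F v)" if "v \<in> ?V" for v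
    using low bound[OF that] by (rule order_trans)
  then show ?thesis
    \<comment> \<open>Instantiating \<open>approx_def\<close> at the constant rule keeps
      \<open>approx l h F A\<close> folded; \<open>L\<close> makes the set under \<open>Min\<close>
      nonempty.\<close>
    using L unfolding const_transform_def approx_def[of l h F "\<lambda>v. A ?L"]
    by (subst Min_ge_iff) (auto simp: finite_valuations)
qed

end
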